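(* Let $q=p$ be a prime, let $v$ be a prime of $\mathbb{F}_p[t]$ of degree one, let $z\in\mathbb{Z}/(p-1)\mathbb{Z}$, let $m>0$ be an integer, put $y=(z,m)$, and let $r$ be the least non-negative residue of $z$ modulo $p-1$. Write $m=\sum_{i=1}^{\ell}p^{e_i}$ with $e_1\le e_2\le\cdots\le e_\ell$ and with no value repeated more than $p-1$ times (i.e. the base-$p$ digit expansion of $m$ taken one unit of a digit at a time, so $\ell$ is the base-$p$ digit sum of $m$). Let $d\ge 1$. Then $v_d(y)=\infty$ if $\ell<(p-1)(d-1)+r$, and otherwise $$v_d(y)=d\sum_{i=1}^{r}p^{e_i}+\sum_{j=1}^{d-1}j\sum_{i=1}^{p-1}p^{e_{(d-1-j)(p-1)+r+i}}.$$
   Context: For a monic $a\in\mathbb{F}_p[t]$ of degree $d$ coprime to $v$, let $\omega(a)\in\mathbb{F}_p^*$ be the unique element with $a\equiv\omega(a)\pmod v$, and define $a^y:=\omega(a)^z\,(a/\omega(a))^m$ for $y=(z,m)$. Define $$S_{d,v}(y)=\sum_{\substack{a\in\mathbb{F}_p[t]\text{ monic}\\ \deg a=d,\ (v,a)=1}} a^y,\qquad v_d(y)=\mathrm{val}_v(S_{d,v}(y)),$$ where $\mathrm{val}_v$ is the $v$-adic valuation with $\mathrm{val}_v(0)=\infty$. *)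

theory Defs
  imports
    "Berlekamp_Zassenhaus.Finite_Field"
    "HOL-Computational_Algebra.Computational_Algebra"
    "HOL-Number_Theory.Cong"
    "HOL-Library.Extended_Nat"
begin

text \<open>
  The field with \<open>p\<close> elements is the type \<open>'p mod_ring\<close> with \<open>CARD('p) = p\<close>; the class
  \<^class>\<open>prime_card\<close> says that this cardinality is prime.
\<close>

text \<open>
  This is meaningful only if \<open>v\<close> has degree one and is coprime to \<open>a\<close>; then existence and
  uniqueness hold (lemma \<open>omega_unique\<close>).
\<close>

definition omega :: "'p::prime_card mod_ring poly \<Rightarrow> 'p mod_ring poly \<Rightarrow> 'p mod_ring" where
  "omega v a = (THE c. c \<noteq> 0 \<and> [a = [:c:]] (mod v))"

lemma omega_unique:
  fixes v a :: "'p::prime_card mod_ring poly"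
  assumes "degree v = 1" and "coprime v a"
  shows "\<exists>!c. c \<noteq> 0 \<and> [a = [:c:]] (mod v)"
proof -
  have "v \<noteq> 0"
    using assms(1) by auto
  then have "degree (a mod v) = 0"
    using degree_mod_less[of v a] assms(1) by auto
  then obtain c where c: "a mod v = [:c:]"
    by (rule degree_eq_zeroE)
  have const: "[:b:] mod v = [:b:]" for b
    using assms(1) by (simp add: mod_poly_less)
  have "c \<noteq> 0"
  proof
    assume "c = 0"
    then have "v dvd a"
      using c by (simp add: mod_eq_0_iff_dvd)
    then have "is_unit v"
      using assms(2) by (meson coprime_common_divisor dvd_refl)
    then show False
      using assms(1) by (simp add: poly_dvd_1)
  qed
  then show ?thesis
    using c const by (auto simp: cong_def)
qed

text \<open>
  An element of \<open>\<int>/(p-1)\<int>\<close> is given by an arbitrary integer representative \<open>z\<close>. The value does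
  not depend on the choice, because \<open>c ^ (p-1) = 1\<close> for every nonzero \<open>c\<close> of the field.
\<close>

definition v_power ::
  "'p::prime_card mod_ring poly \<Rightarrow> 'p mod_ring poly \<Rightarrow> int \<times> nat \<Rightarrow> 'p mod_ring poly" where
  "v_power v a y =
     smult (omega v a powi fst y) (smult (inverse (omega v a)) a ^ snd y)"

lemma finite_monic_coprime:
  fixes v :: "'p::prime_card mod_ring poly"
  shows "finite {a. lead_coeff a = 1 \<and> degree a = d \<and> coprime v a}"
proof (rule finite_subset)
  show "{a. lead_coeff a = 1 \<and> degree a = d \<and> coprime v a}
      \<subseteq> Poly ` {xs. set xs \<subseteq> UNIV \<and> length xs \<le> Suc d}"
  proof
    fix a :: "'p mod_ring poly"
    assume "a \<in> {a. lead_coeff a = 1 \<and> degree a = d \<and> coprime v a}"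
    then have "length (coeffs a) \<le> Suc d"
      by (auto simp: length_coeffs_degree[of a] coeffs_def)
    then show "a \<in> Poly ` {xs. set xs \<subseteq> UNIV \<and> length xs \<le> Suc d}"
      by (intro image_eqI[of _ _ "coeffs a"]) auto
  qed
  show "finite (Poly ` {xs :: 'p mod_ring list. set xs \<subseteq> UNIV \<and> length xs \<le> Suc d})"
    by (intro finite_imageI finite_lists_length_le) simp
qed

definition S_dv :: "'p::prime_card mod_ring poly \<Rightarrow> nat \<Rightarrow> int \<times> nat \<Rightarrow> 'p mod_ring poly" where
  "S_dv v d y = (\<Sum>a | lead_coeff a = 1 \<and> degree a = d \<and> coprime v a. v_power v a y)"

definition val_v :: "'p::prime_card mod_ring poly \<Rightarrow> 'p mod_ring poly \<Rightarrow> enat" where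
  "val_v v f = (if f = 0 then \<infinity> else enat (multiplicity v f))"

definition v_d :: "'p::prime_card mod_ring poly \<Rightarrow> nat \<Rightarrow> int \<times> nat \<Rightarrow> enat" where
  "v_d v d y = val_v v (S_dv v d y)"

end

theory Submission
  imports Defs
begin

text \<open>
  Let \<open>v = \<gamma> X\<close> with \<open>X = t - \<alpha>\<close>. A monic \<open>a\<close> of degree \<open>d\<close> prime to \<open>v\<close>, divided by its residue, is
  \<open>1 + g\<^sub>1 X + \<dots> + g\<^sub>d X\<^sup>d\<close> with \<open>g\<^sub>j\<close> arbitrary for \<open>j < d\<close> and \<open>g\<^sub>d\<close> the inverse of the residue.
  Since the Frobenius map fixes the coefficients, the \<open>m\<close>-th power is a product of \<open>l\<close> factors
  \<open>\<Sum>j. g\<^sub>j X ^ (j p ^ e i)\<close>; expanding it gives a sum over maps \<open>f\<close> from \<open>{1..l}\<close> to \<open>{0..d}\<close>.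
  Summing over \<open>g\<close> leaves, with the common coefficient \<open>(-1)\<^sup>d\<close>, only those \<open>f\<close> whose fibers over
  \<open>1, \<dots>, d-1\<close> have positive size divisible by \<open>p-1\<close> and whose fiber over \<open>d\<close> has size congruent
  to \<open>z\<close> modulo \<open>p-1\<close>.

  The exponent \<open>\<Sum>i. f i p ^ e i\<close> is the sum of the weights of the superlevel sets \<open>{i. f i > j}\<close>, which
  have at least \<open>r + (d-1-j)(p-1)\<close> elements, so it is minimal exactly if every superlevel set is a
  lightest set of this size. Building the chain of superlevel sets from the smallest one, the
  number of extensions at each step is a binomial coefficient with upper entry below \<open>p\<close>. Hence
  the number of minimal \<open>f\<close> is prime to \<open>p\<close>, and the lowest term does not cancel.
\<close>

section \<open>Lightest sets of unit digits\<close>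

locale unit_digits =
  fixes p l :: nat and e :: "nat \<Rightarrow> nat"
  assumes prime_p: "prime p"
    and sorted: "\<And>i j. 1 \<le> i \<Longrightarrow> i \<le> j \<Longrightarrow> j \<le> l \<Longrightarrow> e i \<le> e j"
    and repeats: "\<And>k. card {i \<in> {1..l}. e i = k} \<le> p - 1"
begin

definition wt :: "nat set \<Rightarrow> nat" where
  "wt A = (\<Sum>i\<in>A. p ^ e i)"

text \<open>For 0 < N \<le> l, this and \<open>upper\<close> are the indices of exponent below,
  respectively at most, \<open>e N\<close>. The existential form covers N = 0, where
  \<open>e 0\<close> is unconstrained.\<close>

definition lower :: "nat \<Rightarrow> nat set" where
  "lower N = {i \<in> {1..l}. \<exists>j\<in>{1..N}. e i < e j}"

definition upper :: "nat \<Rightarrow> nat set" where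
  "upper N = {i \<in> {1..l}. \<exists>j\<in>{1..N}. e i \<le> e j}"

text \<open>Minimality is encoded as having the weight of the initial segment, which
  \<open>wt_ge_initial\<close> justifies.\<close>

definition lightest :: "nat \<Rightarrow> nat set set" where
  "lightest N = {A. A \<subseteq> {1..l} \<and> card A = N \<and> wt A = wt {1..N}}"

lemma p_gt_1: "p > 1"
  using prime_p prime_gt_1_nat by blast

lemma lower_conv:
  assumes "1 \<le> N" "N \<le> l"
  shows "lower N = {i \<in> {1..l}. e i < e N}"
proof -
  have "(\<exists>j\<in>{1..N}. x < e j) \<longleftrightarrow> x < e N" for x
    using assms sorted[of _ N] by (meson atLeastAtMost_iff order_less_le_trans order_refl)
  then show ?thesis by (simp add: lower_def)
qed

lemma upper_conv:
  assumes "1 \<le> N" "N \<le> l"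
  shows "upper N = {i \<in> {1..l}. e i \<le> e N}"
proof -
  have "(\<exists>j\<in>{1..N}. x \<le> e j) \<longleftrightarrow> x \<le> e N" for x
    using assms sorted[of _ N] by (meson atLeastAtMost_iff order_trans order_refl)
  then show ?thesis by (simp add: upper_def)
qed

lemma lower_0 [simp]: "lower 0 = {}" and upper_0 [simp]: "upper 0 = {}"
  by (simp_all add: lower_def upper_def)

lemma lower_subset:
  assumes "N \<le> l"
  shows "lower N \<subseteq> {1..N}"
proof (cases "N = 0")
  case False
  have "i \<le> N" if "i \<le> l" "e i < e N" for i
    using sorted[of N i] that False by linarith
  then show ?thesis
    using False assms by (auto simp: lower_conv)
qed simp

lemma subset_upper: "N \<le> l \<Longrightarrow> {1..N} \<subseteq> upper N"
  by (auto simp: upper_def)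

lemma upper_subset: "upper N \<subseteq> {1..l}"
  by (auto simp: upper_def)

text \<open>Exchange argument: compare A with B = {1..N} outside their intersection. Elements of A -
  B weigh at least \<open>p ^ e N\<close>, those of B - A at most that, and A - B is no smaller than
  B - A. Equality of weights makes all three comparisons equalities.\<close>

lemma wt_ge_initial:
  assumes "A \<subseteq> {1..l}" "N \<le> card A" "N \<le> l"
  shows "wt {1..N} \<le> wt A"
    and "wt A = wt {1..N} \<Longrightarrow> card A = N \<and> lower N \<subseteq> A \<and> A \<subseteq> upper N"
proof -
  have "wt {1..N} \<le> wt A \<and> (wt A = wt {1..N} \<longrightarrow> card A = N \<and> lower N \<subseteq> A \<and> A \<subseteq> upper N)"
  proof (cases "N = 0")
    case True
    have "finite A" using assms finite_subset by blast
    then have "wt A = 0 \<longrightarrow> A = {}"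
      using p_gt_1 by (auto simp: wt_def)
    then show ?thesis using True by (auto simp: wt_def)
  next
    case False
    define B where "B = {1..N}"
    define K where "K = p ^ e N"
    have fin: "finite A" "finite B" and B: "B \<subseteq> {1..l}" and cardB: "card B = N"
      using assms finite_subset by (auto simp: B_def)
    have wA: "wt A = wt (A \<inter> B) + wt (A - B)" and wB: "wt B = wt (A \<inter> B) + wt (B - A)"
      unfolding wt_def using sum.Int_Diff[of A _ B] sum.Int_Diff[of B _ A] fin
      by (simp_all add: Int_commute)
    have cA: "card A = card (A \<inter> B) + card (A - B)" and cB: "card B = card (A \<inter> B) + card (B - A)"
      using card_Int_Diff[of A B] card_Int_Diff[of B A] fin by (simp_all add: Int_commute)
    have hi: "K \<le> p ^ e i" if "i \<in> A - B" for i
      unfolding K_def using that assms False sorted[of N i] p_gt_1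
      by (intro power_increasing) (auto simp: B_def)
    have lo: "p ^ e i \<le> K" if "i \<in> B - A" for i
      unfolding K_def using that assms sorted[of i N] p_gt_1
      by (intro power_increasing) (auto simp: B_def)
    have 1: "card (A - B) * K \<le> wt (A - B)"
      unfolding wt_def using sum_mono[of "A - B" "\<lambda>_. K"] hi by simp
    have 2: "wt (B - A) \<le> card (B - A) * K"
      unfolding wt_def using sum_mono[of "B - A" _ "\<lambda>_. K"] lo by simp
    have 3: "card (B - A) * K \<le> card (A - B) * K"
      using assms cA cB cardB by (intro mult_right_mono) auto
    have le: "wt B \<le> wt A" using 1 2 3 wA wB by linarith
    moreover have "card A = N \<and> lower N \<subseteq> A \<and> A \<subseteq> upper N" if eq: "wt A = wt B"
    proof (intro conjI)
      have "card (B - A) * K = card (A - B) * K"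
        using 1 2 3 wA wB eq by linarith
      then show "card A = N"
        using cA cB cardB p_gt_1 by (simp add: K_def)
      have eq1: "wt (B - A) = card (B - A) * K" and eq2: "wt (A - B) = card (A - B) * K"
        using 1 2 3 wA wB eq by linarith+
      show "lower N \<subseteq> A"
      proof (rule ccontr)
        assume "\<not> lower N \<subseteq> A"
        then obtain i where i: "i \<in> lower N" "i \<notin> A" by blast
        then have "i \<in> B - A" using lower_subset[OF assms(3)] by (auto simp: B_def)
        moreover have "p ^ e i < K"
          using i assms False p_gt_1 by (simp add: K_def lower_conv)
        ultimately have "wt (B - A) < (\<Sum>i\<in>B - A. K)"
          unfolding wt_def using lo fin by (intro sum_strict_mono_ex1) auto
        then show False using eq1 by simp
      qed
      show "A \<subseteq> upper N"
      proof (rule ccontr)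
        assume "\<not> A \<subseteq> upper N"
        then obtain i where i: "i \<in> A" "i \<notin> upper N" by blast
        then have "i \<in> A - B" using subset_upper[OF assms(3)] by (auto simp: B_def)
        moreover have "K < p ^ e i"
          using i assms False p_gt_1 by (auto simp: K_def upper_conv)
        ultimately have "(\<Sum>i\<in>A - B. K) < wt (A - B)"
          unfolding wt_def using hi fin by (intro sum_strict_mono_ex1) auto
        then show False using eq2 by simp
      qed
    qed
    ultimately show ?thesis by (auto simp: B_def)
  qed
  then show "wt {1..N} \<le> wt A"
    and "wt A = wt {1..N} \<Longrightarrow> card A = N \<and> lower N \<subseteq> A \<and> A \<subseteq> upper N" by auto
qed

text \<open>So a lightest set can only be varied among the indices \<open>i\<close> with \<open>e i = e N\<close>, fewer than \<open>p\<close> in number.\<close>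

lemma lightest_iff:
  assumes "N \<le> l"
  shows "A \<in> lightest N \<longleftrightarrow> lower N \<subseteq> A \<and> A \<subseteq> upper N \<and> card A = N"
proof
  assume "A \<in> lightest N"
  then show "lower N \<subseteq> A \<and> A \<subseteq> upper N \<and> card A = N"
    using wt_ge_initial(2)[of A N] assms by (auto simp: lightest_def)
next
  assume A: "lower N \<subseteq> A \<and> A \<subseteq> upper N \<and> card A = N"
  have sub: "A \<subseteq> {1..l}" using A upper_subset by blast
  then have fin: "finite A" using finite_subset by blast
  have "wt A = wt {1..N}"
  proof (cases "N = 0")
    case True
    then show ?thesis using A by simp
  next
    case False
    define B where "B = {1..N}"
    have wA: "wt A = wt (A \<inter> B) + wt (A - B)" and wB: "wt B = wt (A \<inter> B) + wt (B - A)"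
      unfolding wt_def using sum.Int_Diff[of A _ B] sum.Int_Diff[of B _ A] fin
      by (simp_all add: Int_commute B_def)
    have "card A = card (A \<inter> B) + card (A - B)" and "card B = card (A \<inter> B) + card (B - A)"
      using card_Int_Diff[of A B] card_Int_Diff[of B A] fin by (simp_all add: Int_commute B_def)
    then have c: "card (A - B) = card (B - A)" using A by (simp add: B_def)
    \<comment> \<open>A and B can differ only at exponent \<open>e N\<close>, so equal cardinality
      gives equal weight.\<close>
    have "e i = e N" if "i \<in> A - B" for i
      using that A sub assms False sorted[of N i] by (fastforce simp: B_def upper_conv)
    then have 1: "wt (A - B) = card (A - B) * p ^ e N"
      by (simp add: wt_def)
    have "e i = e N" if "i \<in> B - A" for i
      using that A assms False sorted[of i N] by (fastforce simp: B_def lower_conv)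
    then have "wt (B - A) = card (B - A) * p ^ e N"
      by (simp add: wt_def)
    then show ?thesis using 1 c wA wB by (simp add: B_def)
  qed
  then show "A \<in> lightest N" using A sub by (auto simp: lightest_def)
qed

section \<open>Counting lightest supersets modulo p\<close>

lemma prime_not_dvd_binomial:
  assumes "n < p" "k \<le> n"
  shows "\<not> p dvd (n choose k)"
proof
  assume "p dvd (n choose k)"
  then have "p dvd fact n"
    using binomial_fact_lemma[OF assms(2)] by (metis dvd_mult)
  then show False using prime_dvd_fact_iff[OF prime_p] assms by auto
qed

text \<open>The supersets are the sets of size N' between \<open>lower N' \<union> A\<close> and
  \<open>upper N'\<close>. Their number is a binomial coefficient depending only on N and N', so
  that counts multiply along a chain; its upper entry is below p.\<close>

lemma card_lightest_supersets:
  assumes "N \<le> N'" "N' \<le> l"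
  shows "\<exists>c. \<not> p dvd c \<and> (\<forall>A\<in>lightest N. card {A' \<in> lightest N'. A \<subseteq> A'} = c)"
proof (cases "N' = 0")
  case True
  then have "{A' \<in> lightest N'. A \<subseteq> A'} = {{}}" if "A \<in> lightest N" for A
    using that assms by (auto simp: lightest_iff)
  then show ?thesis using p_gt_1 by (intro exI[of _ 1]) auto
next
  case False
  \<comment> \<open>\<open>x\<close> is the size of \<open>lower N' \<union> A\<close>: since \<open>A\<close> is lightest, these two sets are always nested.\<close>
  define x where "x = max (card (lower N')) N"
  have finU: "finite (upper N')" using upper_subset finite_subset by blast
  have card_low: "card (lower N') \<le> N'"
    using card_mono[OF _ lower_subset[OF assms(2)]] by simp
  have card_up: "N' \<le> card (upper N')"
    using card_mono[OF finU subset_upper[OF assms(2)]] by simp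
  have low_up: "lower N' \<subseteq> upper N'"
    using False assms by (auto simp: lower_conv upper_conv)
  \<comment> \<open>The gap is a single digit of the expansion, hence at most p - 1.\<close>
  have "card (upper N') - card (lower N') = card (upper N' - lower N')"
    using card_Diff_subset[OF finite_subset[OF low_up finU] low_up] by simp
  also have "\<dots> = card {i \<in> {1..l}. e i = e N'}"
    using False assms by (intro arg_cong[where f = card]) (auto simp: lower_conv upper_conv)
  also have "\<dots> < p" using repeats[of "e N'"] p_gt_1 by linarith
  finally have gap: "card (upper N') - card (lower N') < p" .
  have "card {A' \<in> lightest N'. A \<subseteq> A'} = (card (upper N') - x choose (N' - x))"
    if A: "A \<in> lightest N" for A
  proof -
    have A': "lower N \<subseteq> A" "A \<subseteq> upper N" "card A = N"
      using A assms by (auto simp: lightest_iff)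
    have AU: "A \<subseteq> upper N'" using A' assms by (fastforce simp: upper_def)
    have finA: "finite A" using AU finU finite_subset by blast
    define L where "L = lower N' \<union> A"
    have finL: "finite L" using low_up AU finU finite_subset unfolding L_def by (metis Un_least)
    have "A \<subseteq> lower N' \<or> lower N' \<subseteq> A"
    \<comment> \<open>In the first case \<open>upper N\<close> lies in \<open>lower N'\<close>;
      otherwise the exponents agree and \<open>lower N'\<close> coincides with
      \<open>lower N\<close>.\<close>
    proof (cases "N = 0 \<or> e N < e N'")
      case True
      have "A \<subseteq> lower N'"
      proof (cases "N = 0")
        case False
        then show ?thesis using True A' assms \<open>N' \<noteq> 0\<close> by (auto simp: lower_conv upper_conv)
      qed (use A' in auto)
      then show ?thesis by simp
    next
      case False
      then have "e N = e N'" using sorted[of N N'] assms by auto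
      then have "lower N' = lower N" using False \<open>N' \<noteq> 0\<close> assms by (auto simp: lower_conv)
      then show ?thesis using A' by simp
    qed
    then have cL: "card L = x"
    proof
      assume "A \<subseteq> lower N'"
      then show ?thesis
        using card_mono[OF finite_subset[OF low_up finU], of A] A'
        by (simp add: L_def x_def Un_absorb2 max_def)
    next
      assume "lower N' \<subseteq> A"
      then show ?thesis
        using card_mono[OF finA, of "lower N'"] A' by (simp add: L_def x_def Un_absorb1 max_def)
    qed
    have "{A' \<in> lightest N'. A \<subseteq> A'} = {A'. L \<subseteq> A' \<and> A' \<subseteq> upper N' \<and> card A' = N'}"
      using assms by (auto simp: lightest_iff L_def)
    also have "card \<dots> = card {C. C \<subseteq> upper N' - L \<and> card C = N' - x}"
    proof (rule bij_betw_same_card[of "\<lambda>A'. A' - L"], rule bij_betwI[where g = "\<lambda>C. C \<union> L"])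
      show "(\<lambda>A'. A' - L) \<in> {A'. L \<subseteq> A' \<and> A' \<subseteq> upper N' \<and> card A' = N'} \<rightarrow>
          {C. C \<subseteq> upper N' - L \<and> card C = N' - x}"
        using cL by (auto simp: card_Diff_subset finL)
      show "(\<lambda>C. C \<union> L) \<in> {C. C \<subseteq> upper N' - L \<and> card C = N' - x} \<rightarrow>
          {A'. L \<subseteq> A' \<and> A' \<subseteq> upper N' \<and> card A' = N'}"
      proof
        fix C assume C: "C \<in> {C. C \<subseteq> upper N' - L \<and> card C = N' - x}"
        then have "finite C" using finU finite_subset by blast
        then have "card (C \<union> L) = N' - x + x"
          using C finL cL by (subst card_Un_disjoint) auto
        then show "C \<union> L \<in> {A'. L \<subseteq> A' \<and> A' \<subseteq> upper N' \<and> card A' = N'}"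
          using C low_up AU card_low assms by (auto simp: L_def x_def)
      qed
    qed auto
    also have "\<dots> = (card (upper N' - L) choose (N' - x))"
      by (rule n_subsets) (use finU in auto)
    also have "card (upper N' - L) = card (upper N') - x"
      using cL finL low_up AU by (subst card_Diff_subset) (auto simp: L_def)
    finally show ?thesis .
  qed
  moreover have "\<not> p dvd (card (upper N') - x choose (N' - x))"
    using gap card_up by (intro prime_not_dvd_binomial) (auto simp: x_def)
  ultimately show ?thesis by blast
qed

text \<open>Maps into {0..d} encode chains of nested sets through their superlevel sets. Indexing
  the sizes by d - j lets the passage from d to d + 1 add one outermost set, the new
  support.\<close>

definition layers :: "(nat \<Rightarrow> nat) \<Rightarrow> nat \<Rightarrow> (nat \<Rightarrow> nat) set" where
  "layers N d = {f \<in> {1..l} \<rightarrow>\<^sub>E {0..d}. \<forall>j<d. {i \<in> {1..l}. j < f i} \<in> lightest (N (d - j))}"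

lemma finite_layers: "finite (layers N d)"
  unfolding layers_def by (rule finite_subset[of _ "{1..l} \<rightarrow>\<^sub>E {0..d}"]) (auto intro: finite_PiE)

lemma support_layers:
  assumes "N 0 = 0" "f \<in> layers N d"
  shows "{i \<in> {1..l}. 0 < f i} \<in> lightest (N d)"
proof (cases "d = 0")
  case True
  then have "{i \<in> {1..l}. 0 < f i} = {}"
    using assms by (auto simp: layers_def PiE_def Pi_def)
  moreover have "{} \<in> lightest (N d)" using assms True by (simp add: lightest_def)
  ultimately show ?thesis by (simp only:)
next
  case False
  then show ?thesis using assms by (auto simp: layers_def)
qed

text \<open>A chain with one more set is a shorter chain together with a lightest superset of its
  support. The number of such supersets is the same for every chain and prime to p, so the count is
  multiplied by it.\<close>

lemma not_dvd_card_layers: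
  assumes "mono N" "N 0 = 0" "N d \<le> l"
  shows "\<not> p dvd card (layers N d)"
  using assms(3)
proof (induction d)
  case 0
  have "layers N 0 = {\<lambda>i\<in>{1..l}. 0}"
    by (auto simp: layers_def)
  then show ?case using p_gt_1 by simp
next
  case (Suc d)
  have le: "N d \<le> N (Suc d)" using \<open>mono N\<close> by (simp add: monoD)
  obtain c where c: "\<not> p dvd c"
    "\<And>A. A \<in> lightest (N d) \<Longrightarrow> card {A' \<in> lightest (N (Suc d)). A \<subseteq> A'} = c"
    using card_lightest_supersets[OF le Suc.prems] by blast
  define S where "S = (SIGMA f:layers N d. {A \<in> lightest (N (Suc d)). {i \<in> {1..l}. 0 < f i} \<subseteq> A})"
  \<comment> \<open>Lowering \<open>f\<close> by one (truncated at 0) removes its largest superlevel set, the support.\<close>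
  have "bij_betw (\<lambda>f. (\<lambda>i\<in>{1..l}. f i - 1, {i \<in> {1..l}. 0 < f i})) (layers N (Suc d)) S"
  proof (rule bij_betwI[where g = "\<lambda>(f, A). \<lambda>i\<in>{1..l}. f i + of_bool (i \<in> A)"])
    show "(\<lambda>f. (\<lambda>i\<in>{1..l}. f i - 1, {i \<in> {1..l}. 0 < f i})) \<in> layers N (Suc d) \<rightarrow> S"
    proof
      fix f assume "f \<in> layers N (Suc d)"
      then have f: "f \<in> {1..l} \<rightarrow>\<^sub>E {0..Suc d}"
        and lay: "\<And>j. j < Suc d \<Longrightarrow> {i \<in> {1..l}. j < f i} \<in> lightest (N (Suc d - j))"
        by (simp_all add: layers_def)
      have "{i \<in> {1..l}. j < (\<lambda>i\<in>{1..l}. f i - 1) i} \<in> lightest (N (d - j))" if "j < d" for j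
      proof -
        have "{i \<in> {1..l}. j < (\<lambda>i\<in>{1..l}. f i - 1) i} = {i \<in> {1..l}. Suc j < f i}"
          by auto
        then show ?thesis using lay[of "Suc j"] that by (simp only: Suc_less_eq diff_Suc_Suc)
      qed
      moreover have "(\<lambda>i\<in>{1..l}. f i - 1) \<in> {1..l} \<rightarrow>\<^sub>E {0..d}"
        using PiE_mem[OF f] by (simp add: le_diff_conv)
      moreover have "{i \<in> {1..l}. 0 < f i} \<in> lightest (N (Suc d))"
        using lay[of 0] by simp
      ultimately show "(\<lambda>i\<in>{1..l}. f i - 1, {i \<in> {1..l}. 0 < f i}) \<in> S"
        by (auto simp: S_def layers_def)
    qed
    show "(\<lambda>(f, A). \<lambda>i\<in>{1..l}. f i + of_bool (i \<in> A)) \<in> S \<rightarrow> layers N (Suc d)"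
    proof (clarify)
      fix f A assume fA: "(f, A) \<in> S"
      let ?g = "\<lambda>i\<in>{1..l}. f i + of_bool (i \<in> A)"
      have f: "f \<in> {1..l} \<rightarrow>\<^sub>E {0..d}"
        and lay: "\<And>j. j < d \<Longrightarrow> {i \<in> {1..l}. j < f i} \<in> lightest (N (d - j))"
        and A: "A \<in> lightest (N (Suc d))" "{i \<in> {1..l}. 0 < f i} \<subseteq> A"
        using fA by (simp_all add: S_def layers_def)
      have "{i \<in> {1..l}. j < ?g i} \<in> lightest (N (Suc d - j))" if "j < Suc d" for j
      proof (cases j)
        case 0
        have "{i \<in> {1..l}. 0 < ?g i} = A"
          using A by (auto simp: lightest_def)
        then show ?thesis using 0 A by simp
      next
        case (Suc k)
        have "{i \<in> {1..l}. j < ?g i} = {i \<in> {1..l}. k < f i}"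
          using A Suc by (auto simp: of_bool_def)
        then show ?thesis using lay[of k] that Suc by (simp only: Suc_less_eq diff_Suc_Suc)
      qed
      moreover have "?g \<in> {1..l} \<rightarrow>\<^sub>E {0..Suc d}"
        using PiE_mem[OF f] by (simp add: of_bool_def le_SucI)
      ultimately show "?g \<in> layers N (Suc d)" by (auto simp: layers_def)
    qed
    show "(\<lambda>(f, A). \<lambda>i\<in>{1..l}. f i + of_bool (i \<in> A))
        (\<lambda>i\<in>{1..l}. f i - 1, {i \<in> {1..l}. 0 < f i}) = f" if "f \<in> layers N (Suc d)" for f
      using that by (auto simp: layers_def PiE_def extensional_def of_bool_def)
    show "(\<lambda>f. (\<lambda>i\<in>{1..l}. f i - 1, {i \<in> {1..l}. 0 < f i}))
        ((\<lambda>(f, A). \<lambda>i\<in>{1..l}. f i + of_bool (i \<in> A)) x) = x" if xS: "x \<in> S" for x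
    proof -
      obtain f A where x: "x = (f, A)" by force
      have f: "f \<in> {1..l} \<rightarrow>\<^sub>E {0..d}" and A: "A \<subseteq> {1..l}" "\<And>i. i \<in> {1..l} \<Longrightarrow> 0 < f i \<Longrightarrow> i \<in> A"
        using xS by (auto simp: x S_def layers_def lightest_def)
      \<comment> \<open>Outside A the truncated difference gives 0, so recovering f needs f to
        vanish there.\<close>
      have f0: "f i = 0" if "i \<in> {1..l}" "i \<notin> A" for i
        using A(2) that by blast
      have "(\<lambda>i\<in>{1..l}. (\<lambda>i\<in>{1..l}. f i + of_bool (i \<in> A)) i - 1) = f"
        using f0 PiE_arb[OF f] by (intro ext) (auto simp: of_bool_def restrict_def)
      moreover have "{i \<in> {1..l}. 0 < (\<lambda>i\<in>{1..l}. f i + of_bool (i \<in> A)) i} = A"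
        using A by auto
      ultimately show ?thesis by (simp add: x)
    qed
  qed
  then have "card (layers N (Suc d)) = card S" by (rule bij_betw_same_card)
  also have "\<dots> = (\<Sum>f\<in>layers N d. c)"
    unfolding S_def
  proof (subst card_SigmaI)
    show "\<forall>a\<in>layers N d. finite {A \<in> lightest (N (Suc d)). {i \<in> {1..l}. 0 < a i} \<subseteq> A}"
      by (auto simp: lightest_def intro: finite_subset[of _ "Pow {1..l}"])
  qed (use c support_layers assms finite_layers in auto)
  also have "\<dots> = card (layers N d) * c" by simp
  finally show ?case
    using Suc c(1) le prime_p by (auto simp: prime_dvd_mult_iff)
qed

section \<open>Weights of balanced maps\<close>

text \<open>For \<open>k > 0\<close> this is the least size of the superlevel set \<open>{i. f i > d - k}\<close> of a balanced map.\<close>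

definition level :: "nat \<Rightarrow> nat \<Rightarrow> nat" where
  "level r k = (if k = 0 then 0 else r + (k - 1) * (p - 1))"

definition fiber :: "(nat \<Rightarrow> nat) \<Rightarrow> nat \<Rightarrow> nat set" where
  "fiber f j = {i \<in> {1..l}. f i = j}"

text \<open>These are the maps whose terms survive summation over the coefficients \<open>g\<close>.
  The fiber over 0 is free because the constant coefficient is normalized to 1.\<close>

definition balanced :: "nat \<Rightarrow> nat \<Rightarrow> (nat \<Rightarrow> nat) set" where
  "balanced r d = {f \<in> {1..l} \<rightarrow>\<^sub>E {0..d}.
     (\<forall>j\<in>{1..<d}. 0 < card (fiber f j) \<and> (p - 1) dvd card (fiber f j)) \<and>
     [card (fiber f d) = r] (mod (p - 1))}"

definition weight :: "(nat \<Rightarrow> nat) \<Rightarrow> nat" where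
  "weight f = (\<Sum>i=1..l. f i * p ^ e i)"

text \<open>Every superlevel set is taken as small and as light as possible.\<close>

definition min_weight :: "nat \<Rightarrow> nat \<Rightarrow> nat" where
  "min_weight r d = (\<Sum>j<d. wt {1..level r (d - j)})"

lemma finite_balanced: "finite (balanced r d)"
  unfolding balanced_def by (rule finite_subset[of _ "{1..l} \<rightarrow>\<^sub>E {0..d}"]) (auto intro: finite_PiE)

lemma mono_level: "mono (level r)"
  by (auto simp: mono_def level_def intro!: mult_right_mono)

lemma level_0 [simp]: "level r 0 = 0"
  by (simp add: level_def)

lemma card_superlevel_Suc:
  "card {i \<in> {1..l}. j < f i} = card {i \<in> {1..l}. Suc j < f i} + card (fiber f (Suc j))"
proof -
  have "{i \<in> {1..l}. j < f i} = {i \<in> {1..l}. Suc j < f i} \<union> fiber f (Suc j)"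
    by (auto simp: fiber_def)
  then show ?thesis
    by (simp only:) (subst card_Un_disjoint, auto simp: fiber_def)
qed

text \<open>From the top down: the fiber over d has at least r elements, since r is the least
  residue of its size, and each fiber over 1, ..., d - 1, having positive size divisible by p - 1,
  adds at least p - 1.\<close>

lemma level_le_card_superlevel:
  assumes "f \<in> balanced r d" "r < p - 1" "j < d"
  shows "level r (d - j) \<le> card {i \<in> {1..l}. j < f i}"
proof -
  have "level r (Suc k) \<le> card {i \<in> {1..l}. d - Suc k < f i}" if "k < d" for k
    using that
  proof (induction k)
    case 0
    have "r \<le> card (fiber f d)"
    proof -
      have "r = r mod (p - 1)" using assms(2) by simp
      also have "\<dots> = card (fiber f d) mod (p - 1)"
        using assms(1) by (auto simp: balanced_def cong_def)
      finally show ?thesis by (metis mod_less_eq_dividend)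
    qed
    then show ?case
      using card_superlevel_Suc[of "d - 1" f] 0 by (simp add: level_def)
  next
    case (Suc k)
    have "d - Suc k \<in> {1..<d}" using Suc.prems by auto
    then have "p - 1 \<le> card (fiber f (d - Suc k))"
      using assms(1) by (auto simp: balanced_def intro: dvd_imp_le)
    moreover have "Suc (d - Suc (Suc k)) = d - Suc k" using Suc.prems by simp
    ultimately show ?case
      using card_superlevel_Suc[of "d - Suc (Suc k)" f] Suc by (simp add: level_def)
  qed
  from this[of "d - Suc j"] show ?thesis using assms(3) by (simp add: Suc_diff_Suc)
qed

text \<open>The value \<open>f i\<close> is the number of j < d with j < \<open>f i\<close>; then
  the sums are interchanged.\<close>

lemma weight_eq_sum_superlevels:
  assumes "f \<in> {1..l} \<rightarrow>\<^sub>E {0..d}"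
  shows "weight f = (\<Sum>j<d. wt {i \<in> {1..l}. j < f i})"
proof -
  have "f i * p ^ e i = (\<Sum>j<d. if j < f i then p ^ e i else 0)" if "i \<in> {1..l}" for i
  proof -
    have "f i \<le> d" using assms that by auto
    then have "{..<d} \<inter> {j. j < f i} = {..<f i}" by auto
    then show ?thesis by (simp add: sum.If_cases)
  qed
  then have "weight f = (\<Sum>i=1..l. \<Sum>j<d. if j < f i then p ^ e i else 0)"
    by (simp add: weight_def)
  also have "\<dots> = (\<Sum>j<d. \<Sum>i=1..l. if j < f i then p ^ e i else 0)"
    by (rule sum.swap)
  also have "\<dots> = (\<Sum>j<d. wt {i \<in> {1..l}. j < f i})"
    unfolding wt_def by (subst sum.inter_filter[symmetric]) simp_all
  finally show ?thesis .
qed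

text \<open>The support lies in {1..l}. Contrapositively, for smaller l no term survives and the
  valuation is infinite.\<close>

lemma level_le_of_balanced:
  assumes "f \<in> balanced r d" "r < p - 1"
  shows "level r d \<le> l"
proof (cases "d = 0")
  case False
  then have "level r d \<le> card {i \<in> {1..l}. 0 < f i}"
    using level_le_card_superlevel[OF assms, of 0] by simp
  also have "\<dots> \<le> card {1..l}" by (intro card_mono) auto
  finally show ?thesis by simp
qed simp

text \<open>Termwise comparison over the superlevel sets: each has enough elements for
  \<open>wt_ge_initial\<close>. If the totals agree, every single term is minimal.\<close>

lemma balanced_weight:
  assumes "f \<in> balanced r d" "r < p - 1"
  shows "min_weight r d \<le> weight f"
    and "weight f = min_weight r d \<Longrightarrow> f \<in> layers (level r) d"
proof -
  have PiE: "f \<in> {1..l} \<rightarrow>\<^sub>E {0..d}" using assms by (simp add: balanced_def)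
  have lev: "level r (d - j) \<le> l" for j
    using level_le_of_balanced[OF assms] monoD[OF mono_level, of "d - j" d r] by simp
  note le = level_le_card_superlevel[OF assms]
  have ge: "wt {1..level r (d - j)} \<le> wt {i \<in> {1..l}. j < f i}" if "j < d" for j
    by (rule wt_ge_initial(1)) (use le[OF that] lev in auto)
  then show "min_weight r d \<le> weight f"
    unfolding weight_eq_sum_superlevels[OF PiE] min_weight_def by (intro sum_mono) auto
  assume eq: "weight f = min_weight r d"
  have "{i \<in> {1..l}. j < f i} \<in> lightest (level r (d - j))" if "j < d" for j
  proof -
    have "wt {i \<in> {1..l}. j < f i} = wt {1..level r (d - j)}"
    proof (rule ccontr)
      assume "wt {i \<in> {1..l}. j < f i} \<noteq> wt {1..level r (d - j)}"
      then have "wt {1..level r (d - j)} < wt {i \<in> {1..l}. j < f i}"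
        using ge[OF that] by linarith
      then have "min_weight r d < weight f"
        unfolding weight_eq_sum_superlevels[OF PiE] min_weight_def
        using ge that by (intro sum_strict_mono_ex1) blast+
      then show False using eq by simp
    qed
    moreover from this have "card {i \<in> {1..l}. j < f i} = level r (d - j)"
      using wt_ge_initial(2)[of "{i \<in> {1..l}. j < f i}" "level r (d - j)"] le[OF that] lev by blast
    ultimately show ?thesis by (auto simp: lightest_def)
  qed
  then show "f \<in> layers (level r) d" using PiE by (simp add: layers_def)
qed

text \<open>Fiber sizes are differences of consecutive levels: p - 1 over 1, ..., d - 1 and r over
  d. Hence the bound of \<open>balanced_weight\<close> is attained exactly on these maps.\<close>

lemma layers_subset_balanced:
  assumes "f \<in> layers (level r) d" "d \<ge> 1"
  shows "f \<in> balanced r d" and "weight f = min_weight r d"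
proof -
  have PiE: "f \<in> {1..l} \<rightarrow>\<^sub>E {0..d}"
    and lt: "\<And>j. j < d \<Longrightarrow> {i \<in> {1..l}. j < f i} \<in> lightest (level r (d - j))"
    using assms by (auto simp: layers_def)
  \<comment> \<open>Including j = d, where the set is empty and \<open>level r 0\<close> is 0, makes
    the fiber over d such a difference too.\<close>
  have card: "card {i \<in> {1..l}. j < f i} = level r (d - j)" if "j \<le> d" for j
  proof (cases "j = d")
    case True
    then have "{i \<in> {1..l}. j < f i} = {}" using PiE by (auto simp: PiE_def Pi_def)
    then show ?thesis using True by (simp only:) simp
  next
    case False
    then show ?thesis using lt[of j] that by (auto simp: lightest_def)
  qed
  have fib: "card (fiber f j) = level r (Suc (d - j)) - level r (d - j)" if "1 \<le> j" "j \<le> d" for j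
  proof -
    have "Suc (j - 1) = j" "d - (j - 1) = Suc (d - j)" "j - 1 \<le> d" using that by auto
    then show ?thesis
      using card_superlevel_Suc[of "j - 1" f] card[of j] card[of "j - 1"] that
      by (simp only: diff_add_inverse)
  qed
  have "card (fiber f j) = p - 1" if "j \<in> {1..<d}" for j
    using fib[of j] that by (cases "d - j") (auto simp: level_def)
  moreover have "card (fiber f d) = r"
    using fib[of d] assms(2) by (simp add: level_def)
  ultimately show "f \<in> balanced r d"
    using PiE p_gt_1 by (simp add: balanced_def)
  show "weight f = min_weight r d"
    unfolding weight_eq_sum_superlevels[OF PiE] min_weight_def
    using lt by (intro sum.cong) (auto simp: lightest_def)
qed

section \<open>Closed form of the minimal weight\<close>

lemma wt_level_Suc:
  "wt {1..level r (Suc k)} = (\<Sum>i=1..r. p ^ e i) + (\<Sum>s<k. \<Sum>i=1..p-1. p ^ e (s * (p - 1) + r + i))"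
proof (induction k)
  case 0
  then show ?case by (simp add: level_def wt_def)
next
  case (Suc k)
  define n where "n = k * (p - 1) + r"
  have n: "level r (Suc (Suc k)) = n + (p - 1)" "level r (Suc k) = n"
    by (simp_all add: level_def n_def)
  have "wt {1..n + (p - 1)} = wt {1..n} + (\<Sum>i=n+1..n+(p-1). p ^ e i)"
    unfolding wt_def by (rule sum.ub_add_nat) simp
  also have "(\<Sum>i=n+1..n+(p-1). p ^ e i) = (\<Sum>i=1..p-1. p ^ e (n + i))"
    using sum.shift_bounds_cl_nat_ivl[of "\<lambda>i. p ^ e i" 1 n "p - 1"] by (simp add: add.commute)
  finally show ?case using Suc.IH by (simp only: n sum.lessThan_Suc n_def add.assoc)
qed

text \<open>The first r indices lie in all d segments, and block s of p - 1 indices lies in d - 1 -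
  s of them; then j = d - 1 - s.\<close>

lemma min_weight_eq:
  assumes "d \<ge> 1"
  shows "min_weight r d = d * (\<Sum>i=1..r. p ^ e i) +
    (\<Sum>j=1..d-1. j * (\<Sum>i=1..p-1. p ^ e ((d - 1 - j) * (p - 1) + r + i)))"
proof -
  define b where "b = (\<lambda>s. \<Sum>i=1..p-1. p ^ e (s * (p - 1) + r + i))"
  have "min_weight r d = (\<Sum>k<d. wt {1..level r (Suc k)})"
    unfolding min_weight_def
    by (rule sum.reindex_bij_witness[of _ "\<lambda>k. d - Suc k" "\<lambda>k. d - Suc k"]) (auto simp: Suc_diff_Suc)
  also have "\<dots> = d * (\<Sum>i=1..r. p ^ e i) + (\<Sum>k<d. \<Sum>s<k. b s)"
    by (simp only: wt_level_Suc b_def sum.distrib) simp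
  also have "(\<Sum>k<d. \<Sum>s<k. b s) = (\<Sum>s<d. (d - 1 - s) * b s)"
  proof (induction d)
    case (Suc d)
    have "(\<Sum>s<d. (Suc d - 1 - s) * b s) = (\<Sum>s<d. (d - 1 - s) * b s + b s)"
    proof (intro sum.cong refl)
      fix s assume "s \<in> {..<d}"
      then have "Suc d - 1 - s = Suc (d - 1 - s)" by auto
      then show "(Suc d - 1 - s) * b s = (d - 1 - s) * b s + b s"
        by (simp only: mult_Suc add.commute)
    qed
    then show ?case using Suc by (simp add: sum.distrib)
  qed simp
  \<comment> \<open>The summand for s = d - 1 has factor 0.\<close>
  also have "\<dots> = (\<Sum>s<d-1. (d - 1 - s) * b s)"
    using assms by (cases d) auto
  also have "\<dots> = (\<Sum>j=1..d-1. j * b (d - 1 - j))"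
    by (rule sum.reindex_bij_witness[of _ "\<lambda>j. d - 1 - j" "\<lambda>s. d - 1 - s"]) auto
  finally show ?thesis by (simp add: b_def)
qed

end

section \<open>Power sums over the prime field\<close>

lemma unit_power_eq_1:
  fixes u :: "'p::prime_card mod_ring"
  assumes "u \<noteq> 0"
  shows "u ^ (CARD('p) - 1) = 1"
proof -
  have "u * u ^ (CARD('p) - 1) = u * 1"
    using finite_field_power_card_eq_same[of u] prime_gt_0_nat[OF prime_card[where 'a = 'p]]
    by (simp flip: power_Suc)
  then show ?thesis using assms by (simp only: mult_cancel_left) simp
qed

lemma of_nat_card_minus_1: "of_nat (CARD('p) - 1) = (-1 :: 'p::prime_card mod_ring)"
proof -
  have "CARD('p) \<ge> 1" using prime_card[where 'a = 'p] prime_ge_1_nat by blast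
  then have "of_nat (CARD('p) - 1) = (of_nat CARD('p) - 1 :: 'p mod_ring)"
    by (simp add: of_nat_diff)
  then show ?thesis by simp
qed

text \<open>The polynomial \<open>x ^ s - 1\<close> has at most s < p - 1 roots, fewer than there
  are units.\<close>

lemma exists_power_ne_1:
  assumes "0 < s" "s < CARD('p::prime_card) - 1"
  shows "\<exists>c::'p mod_ring. c \<noteq> 0 \<and> c ^ s \<noteq> 1"
proof (rule ccontr)
  assume "\<not> ?thesis"
  then have all: "c ^ s = 1" if "c \<noteq> 0" for c :: "'p mod_ring" using that by blast
  define P where "P = monom (1 :: 'p mod_ring) s - 1"
  have "coeff P s = 1" using assms by (simp add: P_def)
  then have "P \<noteq> 0" by auto
  have "degree P \<le> s"
    unfolding P_def by (intro degree_diff_le) (auto simp: degree_monom_le)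
  moreover have "UNIV - {0} \<subseteq> {x. poly P x = 0}"
    using all by (auto simp: P_def poly_monom)
  then have "card (UNIV - {0 :: 'p mod_ring}) \<le> card {x. poly P x = 0}"
    by (intro card_mono) auto
  then have "CARD('p) - 1 \<le> degree P"
    using card_poly_roots_bound[OF \<open>P \<noteq> 0\<close>] by (simp add: card_Diff_singleton)
  ultimately show False using assms by simp
qed

text \<open>If p - 1 divides k, all p - 1 terms are 1. Otherwise multiplication by a unit c with
  \<open>c powi k\<close> different from 1 permutes the units and scales the sum by that factor, so
  the sum is 0.\<close>

lemma sum_unit_powers:
  "(\<Sum>u\<in>UNIV - {0 :: 'p::prime_card mod_ring}. u powi k) = (if int (CARD('p) - 1) dvd k then -1 else 0)"
proof -
  define q where "q = CARD('p) - 1"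
  have q: "q > 0" using prime_card[where 'a = 'p] prime_gt_1_nat[of "CARD('p)"] by (simp add: q_def)
  have powi_1: "u powi (int q * j) = 1" if "u \<noteq> 0" for u :: "'p mod_ring" and j
    by (simp only: power_int_mult q_def power_int_of_nat unit_power_eq_1[OF that] power_int_1_left)
  show ?thesis
  proof (cases "int q dvd k")
    case True
    then obtain j where k: "k = int q * j" by blast
    have "(\<Sum>u\<in>UNIV - {0 :: 'p mod_ring}. u powi k) = (\<Sum>u\<in>UNIV - {0 :: 'p mod_ring}. 1)"
      using powi_1 by (intro sum.cong) (auto simp: k)
    also have "\<dots> = of_nat q" by (simp add: card_Diff_singleton q_def)
    also have "\<dots> = -1" using of_nat_card_minus_1 by (simp only: q_def)
    finally show ?thesis using True by (simp add: q_def)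
  next
    case False
    define s where "s = nat (k mod int q)"
    have "k mod int q \<noteq> 0" using False mod_eq_0_iff_dvd by blast
    moreover have "0 \<le> k mod int q" "k mod int q < int q" using q by simp_all
    ultimately have s: "0 < s" "s < q" and int_s: "int s = k mod int q"
      unfolding s_def by linarith+
    have ks: "k = int q * (k div int q) + int s" by (simp only: int_s mult_div_mod_eq)
    obtain c :: "'p mod_ring" where c: "c \<noteq> 0" "c ^ s \<noteq> 1"
      using exists_power_ne_1[where 'p = 'p, of s] s by (auto simp: q_def)
    have "c powi k = c ^ s"
      using c(1) powi_1[OF c(1)] power_int_add[of c "int q * (k div int q)" "int s"]
      by (simp only: flip: ks) simp
    have "(\<Sum>u\<in>UNIV - {0}. u powi k) = (\<Sum>u\<in>UNIV - {0}. (c * u) powi k)"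
      by (rule sum.reindex_bij_witness[of _ "\<lambda>u. c * u" "\<lambda>u. u / c"]) (use c in auto)
    also have "\<dots> = c ^ s * (\<Sum>u\<in>UNIV - {0}. u powi k)"
      by (simp add: power_int_mult_distrib sum_distrib_left \<open>c powi k = c ^ s\<close>)
    finally have "(1 - c ^ s) * (\<Sum>u\<in>UNIV - {0}. u powi k) = 0" by (simp add: algebra_simps)
    then show ?thesis using c False by (simp add: q_def)
  qed
qed

text \<open>For n = 0 the convention \<open>0 ^ 0 = 1\<close> gives p ones, hence 0; this is the
  source of the positive fiber sizes in \<open>balanced\<close>.\<close>

lemma sum_powers:
  "(\<Sum>b\<in>UNIV. (b :: 'p::prime_card mod_ring) ^ n) = (if 0 < n \<and> (CARD('p) - 1) dvd n then -1 else 0)"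
proof (cases "n = 0")
  case False
  have "(\<Sum>b\<in>UNIV. (b :: 'p mod_ring) ^ n) = 0 ^ n + (\<Sum>b\<in>UNIV - {0}. b ^ n)"
    by (rule sum.remove) auto
  also have "(\<Sum>b\<in>UNIV - {0}. (b :: 'p mod_ring) ^ n) = (if (CARD('p) - 1) dvd n then -1 else 0)"
    using sum_unit_powers[where 'p = 'p, of "int n"] by (simp only: power_int_of_nat int_dvd_int_iff)
  finally show ?thesis using False by simp
qed simp

section \<open>Expansion of the power sum\<close>

lemma pcompose_power: "pcompose (P ^ n) Q = pcompose P Q ^ n"
  by (induction n) (simp_all add: pcompose_mult pcompose_1)

lemma pcompose_monom: "pcompose (monom c n) Q = smult c (Q ^ n)"
  for Q :: "'a::comm_semiring_1 poly"
  by (simp add: monom_altdef pcompose_smult pcompose_power pcompose_pCons)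

lemma prod_smult_powers:
  "(\<Prod>i\<in>A. smult (a i) (X ^ n i)) = smult (\<Prod>i\<in>A. a i) (X ^ (\<Sum>i\<in>A. n i))"
  by (induction A rule: infinite_finite_induct) (simp_all add: power_add mult_ac)

text \<open>Frobenius is additive and fixes coefficients in the prime field, so only the exponents
  of X change.\<close>

lemma frobenius_sum:
  fixes c :: "nat \<Rightarrow> 'p::prime_card mod_ring"
  shows "(\<Sum>j\<in>J. smult (c j) (X ^ j)) ^ (CARD('p) ^ k) = (\<Sum>j\<in>J. smult (c j) (X ^ (j * CARD('p) ^ k)))"
proof -
  have "(\<Sum>j\<in>J. smult (c j) (X ^ j)) ^ (CARD('p) ^ k) = (\<Sum>j\<in>J. smult (c j) (X ^ j) ^ (CARD('p) ^ k))"
    by (rule freshmans_dream_sum') (simp_all add: prime_card)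
  also have "\<dots> = (\<Sum>j\<in>J. smult (c j) (X ^ (j * CARD('p) ^ k)))"
    by (simp add: smult_power finite_field_power_card_power_eq_same[of _ k] flip: power_mult)
  finally show ?thesis .
qed

text \<open>Choosing one summand from each factor is a map f. Collecting equal coefficients gives
  powers with the fiber sizes as exponents, a form that can be summed over each coefficient
  separately.\<close>

lemma poly_power_expansion:
  fixes c :: "nat \<Rightarrow> 'p::prime_card mod_ring"
  assumes "finite I" "finite J"
  shows "(\<Sum>j\<in>J. smult (c j) (X ^ j)) ^ (\<Sum>i\<in>I. CARD('p) ^ e i) =
    (\<Sum>f\<in>I \<rightarrow>\<^sub>E J. smult (\<Prod>j\<in>J. c j ^ card {i \<in> I. f i = j}) (X ^ (\<Sum>i\<in>I. f i * CARD('p) ^ e i)))"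
proof -
  have "(\<Sum>j\<in>J. smult (c j) (X ^ j)) ^ (\<Sum>i\<in>I. CARD('p) ^ e i) =
      (\<Prod>i\<in>I. \<Sum>j\<in>J. smult (c j) (X ^ (j * CARD('p) ^ e i)))"
    by (simp add: power_sum frobenius_sum)
  also have "\<dots> = (\<Sum>f\<in>I \<rightarrow>\<^sub>E J. \<Prod>i\<in>I. smult (c (f i)) (X ^ (f i * CARD('p) ^ e i)))"
    using assms by (rule prod_sum_PiE)
  also have "\<dots> = (\<Sum>f\<in>I \<rightarrow>\<^sub>E J. smult (\<Prod>i\<in>I. c (f i)) (X ^ (\<Sum>i\<in>I. f i * CARD('p) ^ e i)))"
    by (simp add: prod_smult_powers)
  also have "\<dots> = (\<Sum>f\<in>I \<rightarrow>\<^sub>E J. smult (\<Prod>j\<in>J. c j ^ card {i \<in> I. f i = j}) (X ^ (\<Sum>i\<in>I. f i * CARD('p) ^ e i)))"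
  proof (intro sum.cong refl)
    fix f assume f: "f \<in> I \<rightarrow>\<^sub>E J"
    have "(\<Prod>i\<in>I. c (f i)) = (\<Prod>j\<in>J. \<Prod>i | i \<in> I \<and> f i = j. c (f i))"
      using f assms by (intro prod.group[symmetric]) auto
    also have "\<dots> = (\<Prod>j\<in>J. \<Prod>i | i \<in> I \<and> f i = j. c j)"
      by (intro prod.cong) auto
    finally show "smult (\<Prod>i\<in>I. c (f i)) (X ^ (\<Sum>i\<in>I. f i * CARD('p) ^ e i)) =
        smult (\<Prod>j\<in>J. c j ^ card {i \<in> I. f i = j}) (X ^ (\<Sum>i\<in>I. f i * CARD('p) ^ e i))"
      by simp
  qed
  finally show ?thesis .
qed

lemma multiplicity_smult_power_mult:
  fixes X Q :: "'a::field_gcd poly"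
  assumes "c \<noteq> 0" "X \<noteq> 0" "\<not> X dvd Q"
  shows "multiplicity (smult c X) (X ^ n * Q) = n"
proof (rule multiplicity_eqI)
  show "smult c X ^ n dvd X ^ n * Q"
    using assms by (simp add: smult_power smult_dvd_iff)
  have "\<not> X ^ Suc n dvd X ^ n * Q"
    using assms by (simp add: mult.commute[of X])
  then show "\<not> smult c X ^ Suc n dvd X ^ n * Q"
    using assms by (simp add: smult_power smult_dvd_iff del: power_Suc)
qed

section \<open>The power sum in coordinates at the root of v\<close>

context
  fixes v :: "'p::prime_card mod_ring poly" and \<alpha> \<gamma> :: "'p mod_ring"
  assumes v: "v = smult \<gamma> [:-\<alpha>, 1:]" and \<gamma>: "\<gamma> \<noteq> 0"
begin

lemma coprime_iff_poly_ne_0: "coprime v a \<longleftrightarrow> poly a \<alpha> \<noteq> 0"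
proof -
  have dvd: "v dvd a \<longleftrightarrow> poly a \<alpha> = 0"
    using \<gamma> by (simp add: v smult_dvd_iff poly_eq_0_iff_dvd del: smult_pCons)
  have deg: "degree v = 1" using \<gamma> by (simp add: v)
  show ?thesis
  proof
    assume "coprime v a"
    then have "\<not> v dvd a" using deg by (metis coprime_common_divisor dvd_refl is_unit_iff_degree degree_0 zero_neq_one)
    then show "poly a \<alpha> \<noteq> 0" using dvd by simp
  next
    assume ne: "poly a \<alpha> \<noteq> 0"
    show "coprime v a"
    proof (rule prime_elem_imp_coprime)
      show "prime_elem v" using deg by (simp add: irreducible_linear_field_poly irreducible_imp_prime_elem v \<gamma>)
    qed (use ne dvd in simp)
  qed
qed

text \<open>The linear polynomial t - \<alpha>, a unit multiple of v, divides the difference of a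
  and its value at \<alpha>.\<close>

lemma omega_eq_poly:
  assumes "poly a \<alpha> \<noteq> 0"
  shows "omega v a = poly a \<alpha>"
proof -
  have "degree v = 1" using \<gamma> by (simp add: v)
  moreover have "coprime v a" using assms by (simp add: coprime_iff_poly_ne_0)
  moreover have "[:-\<alpha>, 1:] dvd a - [:poly a \<alpha>:]"
    by (simp flip: poly_eq_0_iff_dvd)
  then have "[a = [:poly a \<alpha>:]] (mod v)"
    using \<gamma> by (simp add: cong_iff_dvd_diff v smult_dvd_iff del: smult_pCons)
  ultimately show ?thesis
    unfolding omega_def using assms omega_unique[of v a] by (intro the1_equality) auto
qed

text \<open>Normal form of a divided by its residue: value 1 at \<alpha>, written in powers of t -
  \<alpha>.\<close>

definition shifted :: "nat \<Rightarrow> (nat \<Rightarrow> 'p mod_ring) \<Rightarrow> 'p mod_ring poly" where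
  "shifted d g = (\<Sum>j\<in>{0..d}. smult ((g(0 := 1)) j) ([:-\<alpha>, 1:] ^ j))"

text \<open>\<open>g 0\<close> is undefined for \<open>g \<in> params d\<close>; the constant coefficient is set to 1 by an update.\<close>

definition params :: "nat \<Rightarrow> (nat \<Rightarrow> 'p mod_ring) set" where
  "params d = (\<Pi>\<^sub>E j\<in>{1..d}. if j = d then UNIV - {0} else UNIV)"

lemma params_nonzero:
  assumes "d \<ge> 1" "g \<in> params d"
  shows "g d \<noteq> 0"
  using PiE_mem[of g "{1..d}" "\<lambda>j. if j = d then UNIV - {0} else UNIV" d] assms
  unfolding params_def by auto

text \<open>Dividing a by its residue makes the leading coefficient \<open>g d\<close> the inverse
  of that residue. So a is recovered by dividing \<open>shifted d g\<close> by \<open>g d\<close>,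
  and the residue to the power z is \<open>g d powi (- z)\<close>.\<close>

lemma S_dv_eq_sum_params:
  assumes "d \<ge> 1"
  shows "S_dv v d (z, m) = (\<Sum>g\<in>params d. smult (g d powi (- z)) (shifted d g ^ m))"
proof -
  define X where "X = [:-\<alpha>, 1:]"
  \<comment> \<open>Composition with t + \<alpha> turns powers of t - \<alpha> into powers of t, so
    that coefficients can be read off.\<close>
  define Y where "Y = [:\<alpha>, 1:]"
  define H where "H = (\<lambda>g. \<Sum>j\<in>{0..d}. monom ((g(0 := 1)) j) j :: 'p mod_ring poly)"
  define A where "A = (\<lambda>g. smult (inverse (g d)) (shifted d g))"
  define G where "G = (\<lambda>a. \<lambda>j\<in>{1..d}. coeff (a \<circ>\<^sub>p Y) j / poly a \<alpha>)"
  have XY: "X \<circ>\<^sub>p Y = [:0, 1:]" "Y \<circ>\<^sub>p X = [:0, 1:]"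
    by (simp_all add: X_def Y_def pcompose_pCons)
  have shifted: "shifted d g = H g \<circ>\<^sub>p X" for g
    by (simp add: shifted_def H_def X_def pcompose_sum pcompose_monom)
  have coeff_H: "coeff (H g) j = (if j \<le> d then (g(0 := 1)) j else 0)" for g j
    by (simp add: H_def coeff_sum coeff_monom)
  have comp_Y: "shifted d g \<circ>\<^sub>p Y = H g" for g
    by (simp add: shifted XY flip: pcompose_assoc)
  have poly_shifted: "poly (shifted d g) \<alpha> = 1" for g
    using coeff_H[of g 0] by (simp add: shifted poly_pcompose X_def poly_0_coeff_0)
  have gd: "g d \<noteq> 0" if "g \<in> params d" for g
    using params_nonzero[OF assms that] .
  have deg_H: "degree (H g) = d" if "g \<in> params d" for g
    using gd[OF that] assms coeff_H[of g] by (intro antisym degree_le le_degree) auto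
  have "S_dv v d (z, m) = (\<Sum>g\<in>params d. v_power v (A g) (z, m))"
    unfolding S_dv_def
  proof (rule sum.reindex_bij_witness[of _ A G])
    fix a assume "a \<in> {a. lead_coeff a = 1 \<and> degree a = d \<and> coprime v a}"
    then have a: "lead_coeff a = 1" "degree a = d" "poly a \<alpha> \<noteq> 0"
      by (auto simp: coprime_iff_poly_ne_0)
    have deg: "degree (a \<circ>\<^sub>p Y) = d" using a by (simp add: degree_pcompose Y_def)
    have lead: "coeff (a \<circ>\<^sub>p Y) d = 1"
      using lead_coeff_comp[of Y a] a deg by (simp add: Y_def)
    show "G a \<in> params d"
      using a lead by (auto simp: G_def params_def)
    have "H (G a) = smult (inverse (poly a \<alpha>)) (a \<circ>\<^sub>p Y)"
    proof (rule poly_eqI)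
      fix j
      show "coeff (H (G a)) j = coeff (smult (inverse (poly a \<alpha>)) (a \<circ>\<^sub>p Y)) j"
        using a coeff_eq_0[of "a \<circ>\<^sub>p Y" j] deg
        by (auto simp: coeff_H G_def divide_inverse Y_def not_le)
    qed
    then have "shifted d (G a) = smult (inverse (poly a \<alpha>)) a"
      by (simp add: shifted pcompose_smult XY flip: pcompose_assoc)
    moreover have "G a d = inverse (poly a \<alpha>)"
      using assms lead by (simp add: G_def divide_inverse)
    ultimately show "A (G a) = a"
      using a by (simp add: A_def)
    then show "v_power v (A (G a)) (z, m) = v_power v a (z, m)" by simp
  next
    fix g assume g: "g \<in> params d"
    have lead: "coeff (H g) d = g d" using assms by (simp add: coeff_H)
    have "degree (shifted d g) = d"
      using deg_H[OF g] by (simp add: shifted degree_pcompose X_def)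
    moreover have "lead_coeff (shifted d g) = g d"
      using lead_coeff_comp[of X "H g"] deg_H[OF g] lead by (simp add: shifted X_def)
    ultimately show "A g \<in> {a. lead_coeff a = 1 \<and> degree a = d \<and> coprime v a}"
      using gd[OF g] by (simp add: A_def coprime_iff_poly_ne_0 poly_shifted)
    show "G (A g) = g"
    proof
      fix j
      show "G (A g) j = g j"
        using g gd[OF g] PiE_arb[of g "{1..d}" _ j] unfolding params_def
        by (auto simp: G_def A_def pcompose_smult comp_Y coeff_H poly_shifted)
    qed
  qed
  also have "\<dots> = (\<Sum>g\<in>params d. smult (g d powi (- z)) (shifted d g ^ m))"
  proof (intro sum.cong refl)
    fix g assume "g \<in> params d"
    then have "g d \<noteq> 0" by (rule gd)
    then have "omega v (A g) = inverse (g d)"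
      by (subst omega_eq_poly) (simp_all add: A_def poly_shifted)
    then show "v_power v (A g) (z, m) = smult (g d powi (- z)) (shifted d g ^ m)"
      using \<open>g d \<noteq> 0\<close> by (simp add: v_power_def A_def power_int_minus power_int_inverse)
  qed
  finally show ?thesis .
qed

text \<open>The summand is a product of functions of the individual \<open>g j\<close>, so the sum
  factors into d power sums, over the units for j = d and over the field otherwise. Each is -1 or
  0.\<close>

lemma sum_params:
  assumes "d \<ge> 1"
  shows "(\<Sum>g\<in>params d. g d powi (- z) * (\<Prod>j\<in>{0..d}. (g(0 := 1)) j ^ n j)) =
    (if (\<forall>j\<in>{1..<d}. 0 < n j \<and> (CARD('p) - 1) dvd n j) \<and> int (CARD('p) - 1) dvd int (n d) - z
     then (-1) ^ d else 0)"
proof -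
  \<comment> \<open>At j = d the power of the residue merges with the power of
    \<open>g d\<close>.\<close>
  define \<phi> where "\<phi> = (\<lambda>j b. if j = d then b powi (int (n d) - z) else (b :: 'p mod_ring) ^ n j)"
  have split: "{0..d} = insert 0 (insert d {1..<d})" "{1..d} = insert d {1..<d}"
    using assms by auto
  have "(\<Sum>g\<in>params d. g d powi (- z) * (\<Prod>j\<in>{0..d}. (g(0 := 1)) j ^ n j)) =
      (\<Sum>g\<in>params d. \<Prod>j\<in>{1..d}. \<phi> j (g j))"
  proof (intro sum.cong refl)
    fix g assume "g \<in> params d"
    then have "g d \<noteq> 0" by (rule params_nonzero[OF assms])
    moreover have "(\<Prod>j\<in>{1..<d}. (g(0 := 1)) j ^ n j) = (\<Prod>j\<in>{1..<d}. \<phi> j (g j))"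
      by (intro prod.cong) (auto simp: \<phi>_def)
    ultimately show "g d powi (- z) * (\<Prod>j\<in>{0..d}. (g(0 := 1)) j ^ n j) = (\<Prod>j\<in>{1..d}. \<phi> j (g j))"
      using assms unfolding split
      by (simp add: \<phi>_def power_int_diff power_int_minus divide_inverse mult_ac)
  qed
  also have "\<dots> = (\<Prod>j\<in>{1..d}. \<Sum>b\<in>(if j = d then UNIV - {0} else UNIV). \<phi> j b)"
    unfolding params_def by (rule prod_sum_PiE[symmetric]) auto
  also have "\<dots> = (\<Sum>u\<in>UNIV - {0 :: 'p mod_ring}. u powi (int (n d) - z)) *
      (\<Prod>j\<in>{1..<d}. \<Sum>b\<in>UNIV. (b :: 'p mod_ring) ^ n j)"
    unfolding split by (simp add: \<phi>_def)
  also have "(\<Prod>j\<in>{1..<d}. \<Sum>b\<in>UNIV. (b :: 'p mod_ring) ^ n j) =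
      (if \<forall>j\<in>{1..<d}. 0 < n j \<and> (CARD('p) - 1) dvd n j then (-1) ^ (d - 1) else 0)"
    by (auto simp: sum_powers prod_zero_iff)
  finally show ?thesis
    using assms by (cases d) (simp_all add: sum_unit_powers)
qed

text \<open>Interchanging the sums over g and f makes the sum of \<open>sum_params\<close> the
  coefficient of each term. All surviving terms share one sign, so later only a count modulo p
  matters.\<close>

lemma S_dv_expansion:
  assumes "d \<ge> 1" "finite I"
  shows "S_dv v d (z, \<Sum>i\<in>I. CARD('p) ^ e i) =
    (\<Sum>f | f \<in> I \<rightarrow>\<^sub>E {0..d} \<and>
        (\<forall>j\<in>{1..<d}. 0 < card {i \<in> I. f i = j} \<and> (CARD('p) - 1) dvd card {i \<in> I. f i = j}) \<and>
        int (CARD('p) - 1) dvd int (card {i \<in> I. f i = d}) - z.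
      smult ((-1) ^ d) ([:-\<alpha>, 1:] ^ (\<Sum>i\<in>I. f i * CARD('p) ^ e i)))"
    (is "_ = sum ?T {f. f \<in> ?F \<and> ?B f}")
proof -
  have smult_if: "smult (if b then x else 0) P = (if b then smult x P else 0)"
    for b and x :: "'p mod_ring" and P
    by simp
  have finF: "finite ?F" using assms by (intro finite_PiE) auto
  have "S_dv v d (z, \<Sum>i\<in>I. CARD('p) ^ e i) =
      (\<Sum>g\<in>params d. \<Sum>f\<in>?F. smult (g d powi (- z) * (\<Prod>j\<in>{0..d}. (g(0 := 1)) j ^ card {i \<in> I. f i = j}))
        ([:-\<alpha>, 1:] ^ (\<Sum>i\<in>I. f i * CARD('p) ^ e i)))"
    unfolding S_dv_eq_sum_params[OF assms(1)]
  proof (intro sum.cong refl)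
    fix g
    show "smult (g d powi (- z)) (shifted d g ^ (\<Sum>i\<in>I. CARD('p) ^ e i)) =
      (\<Sum>f\<in>?F. smult (g d powi (- z) * (\<Prod>j\<in>{0..d}. (g(0 := 1)) j ^ card {i \<in> I. f i = j}))
        ([:-\<alpha>, 1:] ^ (\<Sum>i\<in>I. f i * CARD('p) ^ e i)))"
      unfolding shifted_def poly_power_expansion[OF assms(2) finite_atLeastAtMost]
      by (simp only: smult_sum2 smult_smult)
  qed
  also have "\<dots> = (\<Sum>f\<in>?F. smult (\<Sum>g\<in>params d. g d powi (- z) * (\<Prod>j\<in>{0..d}. (g(0 := 1)) j ^ card {i \<in> I. f i = j}))
        ([:-\<alpha>, 1:] ^ (\<Sum>i\<in>I. f i * CARD('p) ^ e i)))"
    by (subst sum.swap) (simp only: smult_sum)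
  also have "\<dots> = (\<Sum>f\<in>?F. if ?B f then ?T f else 0)"
    unfolding sum_params[OF assms(1)] by (simp only: smult_if)
  also have "\<dots> = sum ?T {f \<in> ?F. ?B f}"
    using finF by (simp add: sum.inter_filter)
  finally show ?thesis by simp
qed

end

section \<open>The valuation\<close>

theorem theorem2:
  fixes v :: "'p::prime_card mod_ring poly"
    and p m d l r :: nat
    and z :: int
    and e :: "nat \<Rightarrow> nat"
  assumes p: "p = CARD('p)"
    and v: "prime_elem v" "degree v = 1"
    and m: "m > 0"
    and r: "r = nat (z mod (int p - 1))"
    and digits: "m = (\<Sum>i=1..l. p ^ e i)"
    and sorted: "\<And>i j. 1 \<le> i \<Longrightarrow> i \<le> j \<Longrightarrow> j \<le> l \<Longrightarrow> e i \<le> e j"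
    and repeats: "\<And>k. card {i \<in> {1..l}. e i = k} \<le> p - 1"
    and d: "d \<ge> 1"
  shows "(l < (p - 1) * (d - 1) + r \<longrightarrow> v_d v d (z, m) = \<infinity>) \<and>
         (l \<ge> (p - 1) * (d - 1) + r \<longrightarrow>
            v_d v d (z, m) =
              enat (d * (\<Sum>i=1..r. p ^ e i) +
                (\<Sum>j=1..d-1. j * (\<Sum>i=1..p-1. p ^ e ((d - 1 - j) * (p - 1) + r + i)))))"
proof -
  have p_eq: "CARD('p) = p" using p by simp
  have "prime p" using prime_card[where 'a = 'p] p by simp
  interpret unit_digits p l e
    using \<open>prime p\<close> sorted repeats by unfold_locales
  have q: "int (p - 1) = int p - 1" "int (p - 1) > 0" using p_gt_1 by simp_all
  have int_r: "int r = z mod int (p - 1)" using r q by simp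
  have r_less: "r < p - 1" using pos_mod_bound[OF q(2), of z] int_r by linarith
  obtain b \<gamma> where v_eq: "v = [:b, \<gamma>:]" and \<gamma>: "\<gamma> \<noteq> 0"
    using v(2) degree1_coeffs by blast
  define \<alpha> where "\<alpha> = - b / \<gamma>"
  define X where "X = [:- \<alpha>, 1:]"
  have vX: "v = smult \<gamma> [:- \<alpha>, 1:]" using \<gamma> by (simp add: v_eq \<alpha>_def)
  \<comment> \<open>This turns the condition on the fiber over d from z into the form used in
    \<open>balanced\<close>.\<close>
  have cong: "int (p - 1) dvd int n - z \<longleftrightarrow> [n = r] (mod (p - 1))" for n
  proof -
    have "[n = r] (mod (p - 1)) \<longleftrightarrow> [int n = z mod int (p - 1)] (mod int (p - 1))"
      by (simp only: cong_int_iff flip: int_r)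
    also have "\<dots> \<longleftrightarrow> [int n = z] (mod int (p - 1))" by (simp add: cong_def)
    finally show ?thesis by (simp only: cong_iff_dvd_diff)
  qed
  define W where "W = min_weight r d"
  have S: "S_dv v d (z, m) = (\<Sum>f\<in>balanced r d. smult ((- 1) ^ d) (X ^ weight f))"
    unfolding digits balanced_def weight_def fiber_def X_def
    using S_dv_expansion[OF vX \<gamma> d, of "{1..l}" z e, unfolded p_eq cong] by simp
  have level: "level r d = (p - 1) * (d - 1) + r"
    using d by (simp add: level_def)
  have "v_d v d (z, m) = \<infinity>" if "l < (p - 1) * (d - 1) + r"
  proof -
    have "balanced r d = {}"
      using level_le_of_balanced[OF _ r_less, of _ d] level that by fastforce
    then show ?thesis by (simp add: v_d_def val_v_def S)
  qed
  moreover have "v_d v d (z, m) = enat W" if l: "l \<ge> (p - 1) * (d - 1) + r"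
  proof -
    \<comment> \<open>All surviving exponents are at least W, so \<open>X ^ W\<close> factors
      out.\<close>
    define Q where "Q = (\<Sum>f\<in>balanced r d. smult ((- 1) ^ d) (X ^ (weight f - W)))"
    have S_Q: "S_dv v d (z, m) = X ^ W * Q"
      unfolding S Q_def sum_distrib_left
    proof (intro sum.cong refl)
      fix f assume "f \<in> balanced r d"
      then have "weight f = W + (weight f - W)"
        using balanced_weight(1)[OF _ r_less] by (simp add: W_def)
      then have "X ^ weight f = X ^ W * X ^ (weight f - W)" by (metis power_add)
      then show "smult ((- 1) ^ d) (X ^ weight f) = X ^ W * smult ((- 1) ^ d) (X ^ (weight f - W))"
        by simp
    qed
    \<comment> \<open>Evaluation at the root kills each term with exponent above W, leaving a signed
      count of the minimal maps.\<close>
    have "poly Q \<alpha> = (\<Sum>f\<in>balanced r d. if f \<in> layers (level r) d then (- 1) ^ d else 0)"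
      unfolding Q_def poly_sum
    proof (intro sum.cong refl)
      fix f assume f: "f \<in> balanced r d"
      have "weight f \<le> W \<longleftrightarrow> f \<in> layers (level r) d"
        using balanced_weight[OF f r_less] layers_subset_balanced(2)[OF _ d] by (auto simp: W_def)
      then show "poly (smult ((- 1) ^ d) (X ^ (weight f - W))) \<alpha> =
          (if f \<in> layers (level r) d then (- 1) ^ d else 0)"
        by (simp add: X_def power_0_left del: smult_pCons)
    qed
    also have "\<dots> = (- 1) ^ d * of_nat (card {f \<in> balanced r d. f \<in> layers (level r) d})"
      using finite_balanced[of r d] by (simp add: sum.inter_filter[symmetric] mult.commute)
    also have "{f \<in> balanced r d. f \<in> layers (level r) d} = layers (level r) d"
      using layers_subset_balanced(1)[OF _ d] by blast
    finally have Q: "poly Q \<alpha> = (- 1) ^ d * of_nat (card (layers (level r) d))" .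
    \<comment> \<open>The field has characteristic p, so a count prime to p stays nonzero in
      it.\<close>
    have "\<not> p dvd card (layers (level r) d)"
      using not_dvd_card_layers[OF mono_level level_0] level l by simp
    then have "poly Q \<alpha> \<noteq> 0"
      by (simp add: Q of_nat_eq_0_iff_char_dvd p_eq)
    then have "\<not> X dvd Q" by (simp add: X_def poly_eq_0_iff_dvd)
    moreover from this have "X ^ W * Q \<noteq> 0" by (auto simp: X_def)
    moreover have "multiplicity v (X ^ W * Q) = W"
      unfolding vX using multiplicity_smult_power_mult[OF \<gamma> _ \<open>\<not> X dvd Q\<close>] by (simp add: X_def)
    ultimately show ?thesis by (simp add: v_d_def val_v_def S_Q)
  qed
  ultimately show ?thesis using min_weight_eq[OF d, of r] by (simp add: W_def)
qed

end
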